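(* Let $\lambda=\mu>0$ be fixed (so that $\rho=\lambda/\mu=1$) and let $(P_t)_{t\ge0}$ be the corresponding $M/M/\infty$ semi-group. Then, for every $s>0$, there exists a constant $c$ (that, for the given semi-group, depends only on $s$) such that, for all $t\ge4$, $$\sup_{f\ge0:\ \int f\,d\pi_1=1}\pi_1\bigl(\{n:P_sf(n)\ge t\}\bigr)\le\frac{c\sqrt{\log\log t}}{t\sqrt{\log t}}.$$
   Context: The supremum is over functions $f\colon\mathbb{N}\to[0,\infty)$ with $\int f\,d\pi_1=1$, $\mathbb{N}=\{0,1,2,\dots\}$. $\pi_1$ is the Poisson probability measure of parameter $1$: $\pi_1(k)=e^{-1}/k!$. The $M/M/\infty$ process with parameters $\lambda,\mu>0$ is the Markov jump process on $\mathbb{N}$ with generator $Lf(n)=n\mu[f(n-1)-f(n)]+\lambda[f(n+1)-f(n)]$. Its semi-group is $P_tf(n)=\mathbb{E}(f(Y_t+Z_t))$, where $Y_t\sim\mathcal{B}(n,e^{-\mu t})$ (binomial) and $Z_t$ is Poisson with mean $\rho(1-e^{-\mu t})$, $\rho=\lambda/\mu$, independent of $Y_t$. *)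

theory Defs
  imports "HOL-Probability.Probability" "HOL-Real_Asymp.Real_Asymp"
begin

text \<open>The library's \<^term>\<open>poisson_pmf r\<close> is specified only for \<open>r > 0\<close>; the Poisson law of
  mean \<open>0\<close>, needed at time \<open>0\<close>, is the point mass at \<open>0\<close>.\<close>

definition poisson0_pmf :: "real \<Rightarrow> nat pmf" where
  "poisson0_pmf r = (if r = 0 then return_pmf 0 else poisson_pmf r)"

definition mminf_law :: "real \<Rightarrow> real \<Rightarrow> real \<Rightarrow> nat \<Rightarrow> nat pmf" where
  "mminf_law lam mu t n =
     map_pmf (\<lambda>(y, z). y + z)
       (pair_pmf (binomial_pmf n (exp (- (mu * t))))
                 (poisson0_pmf (lam / mu * (1 - exp (- (mu * t))))))"

definition mminf_semigroup :: "real \<Rightarrow> real \<Rightarrow> real \<Rightarrow> (nat \<Rightarrow> real) \<Rightarrow> nat \<Rightarrow> real" where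
  "mminf_semigroup lam mu t f n = measure_pmf.expectation (mminf_law lam mu t n) f"

lemma pmf_mminf_law_le:
  assumes "0 < mu" "0 < s"
  shows "\<exists>C. \<forall>k. pmf (mminf_law mu mu s n) k \<le> C * pmf (poisson_pmf 1) k"
proof -
  define p where "p = exp (- (mu * s))"
  define th where "th = 1 - p"
  have p: "0 < p" "p < 1" using assms by (auto simp: p_def)
  have th: "0 < th" "th < 1" using p by (auto simp: th_def)
  let ?A = "binomial_pmf n p" and ?B = "poisson_pmf th"
  have law: "mminf_law mu mu s n = map_pmf (\<lambda>(y, z). y + z) (pair_pmf ?A ?B)"
    using assms th by (simp add: mminf_law_def poisson0_pmf_def p_def th_def)
  have bind: "mminf_law mu mu s n = bind_pmf ?A (\<lambda>y. map_pmf ((+) y) ?B)"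
    unfolding law pair_pmf_def by (simp add: map_pmf_def bind_assoc_pmf bind_return_pmf)
  have "(\<lambda>z. real (Suc (z + n)) ^ n * th ^ z) \<longlonglongrightarrow> 0"
    using th by real_asymp
  then have "Bseq (\<lambda>z. real (Suc (z + n)) ^ n * th ^ z)"
    by (intro convergent_imp_Bseq) (auto simp: convergent_def)
  then obtain K where K: "K > 0" "\<And>z. \<bar>real (Suc (z + n)) ^ n * th ^ z\<bar> \<le> K"
    by (auto simp: Bseq_def)
  define C where "C = K * exp (1 - th)"
  have shift: "pmf (map_pmf ((+) y) ?B) k \<le> C * pmf (poisson_pmf 1) k" if "y \<le> n" for y k
  proof (cases "y \<le> k")
    case True
    then obtain z where z: "k = y + z" by (auto simp: le_iff_add)
    have "real (fact k div fact (k - y)) \<le> real (k ^ y)"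
      using fact_div_fact_le_pow[OF True] of_nat_le_iff by blast
    then have "fact k / fact z \<le> real k ^ y"
      using True fact_dvd[of z k] by (simp add: z real_of_nat_div fact_dvd)
    also have "\<dots> \<le> real (Suc (z + n)) ^ y"
      using that by (intro power_mono) (auto simp: z)
    also have "\<dots> \<le> real (Suc (z + n)) ^ n"
      using that by (intro power_increasing) auto
    finally have "fact k / fact z * th ^ z \<le> real (Suc (z + n)) ^ n * th ^ z"
      using th by (intro mult_right_mono) auto
    also have "\<dots> \<le> K" using K(2)[of z] by linarith
    finally have *: "th ^ z / fact z \<le> K / fact k"
      by (simp add: field_simps)
    have "pmf (map_pmf ((+) y) ?B) k = pmf ?B z"
      unfolding z by (intro pmf_map_inj') (auto simp: inj_on_def)
    also have "\<dots> = th ^ z / fact z * exp (- th)" using th by simp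
    also have "\<dots> \<le> K / fact k * exp (- th)" using * by (intro mult_right_mono) auto
    also have "\<dots> = C * pmf (poisson_pmf 1) k"
      by (simp add: C_def exp_diff exp_minus field_simps)
    finally show ?thesis .
  next
    case False
    then have "pmf (map_pmf ((+) y) ?B) k = 0"
      by (intro pmf_map_outside) auto
    then show ?thesis using K(1) by (simp add: C_def)
  qed
  have "pmf (mminf_law mu mu s n) k \<le> C * pmf (poisson_pmf 1) k" for k
  proof -
    have "pmf (mminf_law mu mu s n) k = measure_pmf.expectation ?A (\<lambda>y. pmf (map_pmf ((+) y) ?B) k)"
      unfolding bind by (simp add: pmf_bind)
    also have "\<dots> \<le> measure_pmf.expectation ?A (\<lambda>_. C * pmf (poisson_pmf 1) k)"
      using p by (intro integral_mono_AE integrable_binomial_pmf)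
        (auto simp: AE_measure_pmf_iff simp del: pmf_poisson intro!: shift)
    finally show ?thesis by simp
  qed
  then show ?thesis by blast
qed

text \<open>Hence the Bochner expectation in \<^const>\<open>mminf_semigroup\<close> never takes the default value
  \<open>0\<close> of a non-integrable function when \<open>f\<close> is integrable for the invariant law.\<close>

lemma integrable_mminf_law:
  fixes f :: "nat \<Rightarrow> real"
  assumes "0 < mu" "0 < s" and f: "integrable (measure_pmf (poisson_pmf 1)) f"
  shows "integrable (measure_pmf (mminf_law mu mu s n)) f"
proof -
  have eq: "integrable (measure_pmf q) f \<longleftrightarrow> integrable (count_space UNIV) (\<lambda>k. pmf q k * f k)"
    for q :: "nat pmf"
    by (simp add: measure_pmf_eq_density integrable_density)
  from pmf_mminf_law_le[OF assms(1,2)] obtain C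
    where C: "\<And>k. pmf (mminf_law mu mu s n) k \<le> C * pmf (poisson_pmf 1) k" by blast
  have "integrable (count_space UNIV) (\<lambda>k. C * (pmf (poisson_pmf 1) k * f k))"
    using f unfolding eq by (rule integrable_mult_right)
  then show ?thesis unfolding eq
  proof (rule Bochner_Integration.integrable_bound)
    show "AE k in count_space UNIV. norm (pmf (mminf_law mu mu s n) k * f k)
        \<le> norm (C * (pmf (poisson_pmf 1) k * f k))"
    proof (rule AE_I2)
      fix k
      have "\<bar>pmf (mminf_law mu mu s n) k\<bar> \<le> \<bar>C * pmf (poisson_pmf 1) k\<bar>"
        using C[of k] pmf_nonneg[of "mminf_law mu mu s n" k] by linarith
      then have "\<bar>pmf (mminf_law mu mu s n) k\<bar> * \<bar>f k\<bar> \<le> \<bar>C * pmf (poisson_pmf 1) k\<bar> * \<bar>f k\<bar>"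
        by (rule mult_right_mono) simp
      then show "norm (pmf (mminf_law mu mu s n) k * f k) \<le> norm (C * (pmf (poisson_pmf 1) k * f k))"
        by (simp only: real_norm_def abs_mult mult.assoc)
    qed
  qed simp
qed

end

theory Submission
  imports Defs
begin

text \<open>Write \<open>\<pi>\<close> for the Poisson law of mean \<open>1\<close> and \<open>K k\<close> for the law at time \<open>s\<close> of the process
  started at \<open>k\<close>, that is, the law of the sum of a binomial variable of parameters \<open>k\<close> and
  \<open>p = exp (- mu * s)\<close> and an independent Poisson variable of mean \<open>1 - p\<close>. The proof rests on
  three facts.

  \<^item> The kernel is spread out: \<open>K k n \<le> B / sqrt (n + 1)\<close> for all \<open>k\<close>, where \<open>B\<close> depends only on \<open>p\<close>
    (\<open>pmf_mminf_law_le_div_sqrt\<close>). For \<open>y \<le> k\<close> a binomial law of parameters \<open>k\<close> and \<open>p\<close> gives the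
    point \<open>y\<close> mass at most of order \<open>1 / sqrt (k + 1) \<le> 1 / sqrt (y + 1)\<close>, and adding a Poisson
    variable of bounded mean changes only the constant.
  \<^item> The kernel is reversible: \<open>\<pi> n * K n k = \<pi> k * K k n\<close> (\<open>mminf_law_reversible\<close>). Hence, if
    \<open>f \<ge> 0\<close> has \<open>\<pi>\<close>-mean \<open>1\<close>, any bound on \<open>K k n\<close> uniform in \<open>k\<close> bounds \<open>\<pi> n * P\<^sub>s f n\<close>
    (\<open>mminf_semigroup_le\<close>).
  \<^item> The tails of \<open>\<pi>\<close> are governed by their first term: \<open>\<pi> {n..} \<le> 1 / n!\<close>
    (\<open>poisson_one_tail_le\<close>).

  Let \<open>n\<close> be the least point at which \<open>P\<^sub>s f \<ge> t\<close>. The set where \<open>P\<^sub>s f \<ge> t\<close> is contained in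
  \<open>{n..}\<close>, so that it has measure at most \<open>1 / n!\<close>, whereas \<open>t \<le> P\<^sub>s f n \<le> e * B * n! / sqrt (n + 1)\<close>.
  The measure is therefore at most \<open>e * B / (t * sqrt (n + 1))\<close>. The trivial bound \<open>K k n \<le> 1\<close>
  gives also \<open>t \<le> e * n!\<close>, which forces \<open>n + 1\<close> to be at least of order \<open>ln t / ln (ln t)\<close>
  (\<open>ln_le_mult_ln_ln\<close>).\<close>

section \<open>Local bounds for binomial probabilities\<close>

lemma central_binomial_square_le: "(2 * n + 1) * ((2 * n) choose n)\<^sup>2 \<le> 16 ^ n"
proof (induction n)
  case (Suc n)
  define C where "C = (2 * n) choose n"
  define D where "D = (2 * Suc n) choose (Suc n)"
  define H where "H = (2 * n + 1) choose n"
  have "(n + 1) * D = 2 * ((n + 1) * H)"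
    using Suc_times_binomial_eq[of "2 * n + 1" n] 
    by (simp add: D_def H_def algebra_simps del: binomial_Suc_Suc)
  also have "(n + 1) * H = (2 * n + 1) * C"
    using binomial_absorb_comp[of "2 * n + 1" n] by (simp add: C_def H_def)
  finally have D: "(n + 1) * D = 2 * ((2 * n + 1) * C)" .
  have "2 * Suc n + 1 = 2 * n + 3" by simp
  then have "(n + 1)\<^sup>2 * ((2 * Suc n + 1) * D\<^sup>2) = (2 * n + 3) * ((n + 1) * D)\<^sup>2"
    by (simp only: power_mult_distrib mult.left_commute)
  also have "\<dots> = 4 * ((2 * n + 3) * (2 * n + 1)) * ((2 * n + 1) * C\<^sup>2)"
  proof -
    have "a * (2 * (b * C))\<^sup>2 = 4 * (a * b) * (b * C\<^sup>2)" for a b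
      by (simp add: power2_eq_square)
    then show ?thesis unfolding D .
  qed
  also have "\<dots> \<le> 4 * (4 * (n + 1)\<^sup>2) * 16 ^ n"
  proof (rule mult_mono)
    show "4 * ((2 * n + 3) * (2 * n + 1)) \<le> 4 * (4 * (n + 1)\<^sup>2)"
      by (simp add: power2_eq_square algebra_simps)
    show "(2 * n + 1) * C\<^sup>2 \<le> 16 ^ n"
      using Suc.IH unfolding C_def .
  qed simp_all
  also have "\<dots> = (n + 1)\<^sup>2 * 16 ^ Suc n" by simp
  finally show ?case unfolding D_def[symmetric] by (subst (asm) mult_le_cancel1) simp
qed simp

lemma binomial_le_two_power_div_sqrt: "real (m choose j) \<le> 2 ^ m / sqrt (real m + 1)"
proof -
  have even: "real ((2 * n) choose n) \<le> 2 ^ (2 * n) / sqrt (2 * real n + 1)" for n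
  proof -
    have "real ((2 * n + 1) * ((2 * n) choose n)\<^sup>2) \<le> real (16 ^ n)"
      using central_binomial_square_le of_nat_le_iff by blast
    then have "(2 * real n + 1) * (real ((2 * n) choose n))\<^sup>2 \<le> (2 ^ (2 * n))\<^sup>2"
      by (simp add: power_mult distrib_right flip: power_even_eq)
    then have "sqrt ((2 * real n + 1) * (real ((2 * n) choose n))\<^sup>2) \<le> 2 ^ (2 * n)"
      by (simp add: real_le_lsqrt)
    then show ?thesis
      by (simp only: real_sqrt_mult) (simp add: field_simps)
  qed
  have "real (m choose j) \<le> real (m choose (m div 2))"
    using binomial_maximum by simp
  also have "\<dots> \<le> 2 ^ m / sqrt (real m + 1)"
  proof (cases "even m")
    case True
    then obtain n where "m = 2 * n" by blast
    then show ?thesis using even[of n] by simp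
  next
    case False
    then obtain n where m: "m = 2 * n + 1" by (auto elim: oddE)
    have "(2 * Suc n) choose (Suc n) = ((2 * n + 1) choose n) + ((2 * n + 1) choose (Suc n))"
      by simp
    also have "(2 * n + 1) choose (Suc n) = (2 * n + 1) choose n"
      using binomial_symmetric[of n "2 * n + 1"] by simp
    \<comment> \<open>the middle entry of an odd row is half the central coefficient of the next row\<close>
    finally have "2 * real (m choose (m div 2)) = real ((2 * Suc n) choose (Suc n))"
      by (simp add: m)
    also have "\<dots> \<le> 2 * (2 ^ m / sqrt (2 * real (Suc n) + 1))"
      using even[of "Suc n"] by (simp add: m)
    also have "\<dots> \<le> 2 * (2 ^ m / sqrt (real m + 1))"
      by (intro mult_left_mono divide_left_mono) (auto simp: m)
    finally show ?thesis by simp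
  qed
  finally show ?thesis .
qed

text \<open>A binomial number, of parameters \<open>k\<close> and \<open>r\<close>, of independent trials of success probability
  \<open>u\<close> each has a binomial number, of parameters \<open>k\<close> and \<open>r * u\<close>, of successes; the identity holds
  for arbitrary real \<open>r\<close> and \<open>u\<close>.\<close>

lemma binomial_thinning:
  fixes r u :: real
  shows "(\<Sum>m\<le>k. (real (k choose m) * r ^ m * (1 - r) ^ (k - m)) *
                 (real (m choose j) * u ^ j * (1 - u) ^ (m - j)))
         = real (k choose j) * (r * u) ^ j * (1 - r * u) ^ (k - j)"
proof (cases "j \<le> k")
  case False
  then show ?thesis by (simp add: binomial_eq_0 sum.neutral)
next
  case True
  let ?g = "\<lambda>m. (real (k choose m) * r ^ m * (1 - r) ^ (k - m)) *
                 (real (m choose j) * u ^ j * (1 - u) ^ (m - j))"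
  have "sum ?g {..k} = sum ?g {j..k}"
    by (intro sum.mono_neutral_right) auto
  also have "\<dots> = (\<Sum>i\<le>k - j. ?g (i + j))"
    using True sum.shift_bounds_cl_nat_ivl[of ?g 0 j "k - j"] by (simp add: atLeast0AtMost)
  also have "\<dots> = (\<Sum>i\<le>k - j. real (k choose j) * (r * u) ^ j *
      (real ((k - j) choose i) * (r * (1 - u)) ^ i * (1 - r) ^ (k - j - i)))"
  proof (intro sum.cong refl)
    fix i assume "i \<in> {..k - j}"
    then have "(k choose (i + j)) * ((i + j) choose j) = (k choose j) * ((k - j) choose i)"
      using True choose_mult[of j "i + j" k] by simp
    then have "real (k choose (i + j)) * real ((i + j) choose j)
        = real (k choose j) * real ((k - j) choose i)"
      by (simp flip: of_nat_mult)
    moreover have "?g (i + j) = (real (k choose (i + j)) * real ((i + j) choose j)) *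
        ((r * u) ^ j * (r * (1 - u)) ^ i * (1 - r) ^ (k - j - i))"
      by (simp add: power_mult_distrib power_add add.commute mult_ac)
    ultimately show "?g (i + j) = real (k choose j) * (r * u) ^ j *
      (real ((k - j) choose i) * (r * (1 - u)) ^ i * (1 - r) ^ (k - j - i))"
      by (simp add: mult_ac)
  qed
  also have "\<dots> = real (k choose j) * (r * u) ^ j * (r * (1 - u) + (1 - r)) ^ (k - j)"
    by (simp add: binomial_ring sum_distrib_left)
  finally show ?thesis by (simp add: algebra_simps)
qed

text \<open>The left side is the mean of \<open>1 / (M + 1)\<close> for a binomial variable \<open>M\<close> of parameters \<open>k\<close>
  and \<open>r\<close>.\<close>

lemma binomial_mean_inverse_Suc_le:
  fixes r :: real
  assumes "0 < r" "r \<le> 1"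
  shows "(\<Sum>m\<le>k. (real (k choose m) * r ^ m * (1 - r) ^ (k - m)) / (real m + 1))
         \<le> 1 / ((real k + 1) * r)"
proof -
  let ?S = "\<Sum>m\<le>k. (real (k choose m) * r ^ m * (1 - r) ^ (k - m)) / (real m + 1)"
  let ?h = "\<lambda>i. real (Suc k choose i) * r ^ i * (1 - r) ^ (Suc k - i)"
  have "((real k + 1) * r) * ?S = (\<Sum>m\<le>k. ?h (Suc m))"
    unfolding sum_distrib_left
  proof (intro sum.cong refl)
    fix m
    have "real (Suc m * (Suc k choose Suc m)) = real (Suc k * (k choose m))"
      by (simp only: Suc_times_binomial)
    then have "real (Suc k choose Suc m) = (real k + 1) * real (k choose m) / (real m + 1)"
      by (simp add: field_simps del: binomial_Suc_Suc)
    then show "(real k + 1) * r * (real (k choose m) * r ^ m * (1 - r) ^ (k - m) / (real m + 1))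
        = ?h (Suc m)"
      by (simp del: binomial_Suc_Suc)
  qed
  also have "\<dots> \<le> ?h 0 + (\<Sum>m\<le>k. ?h (Suc m))"
    using assms by simp
  also have "\<dots> = (\<Sum>i\<le>Suc k. ?h i)"
    by (rule sum.atMost_Suc_shift[symmetric])
  also have "\<dots> = (r + (1 - r)) ^ Suc k"
    by (simp only: binomial_ring)
  finally have "?S * ((real k + 1) * r) \<le> 1" by (simp add: mult.commute)
  then show ?thesis using assms by (subst pos_le_divide_eq) auto
qed

text \<open>For \<open>p \<le> 1 / 2\<close> the binomial law of parameters \<open>k\<close> and \<open>p\<close> arises from a binomial number \<open>M\<close>,
  of parameters \<open>k\<close> and \<open>2 * p\<close>, of fair coin tosses. Given \<open>M\<close>, the mass of each point is at most
  \<open>1 / sqrt (M + 1)\<close> by the bound on central binomial coefficients, and \<open>M\<close> is typically of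
  order \<open>k\<close>.\<close>

lemma binomial_prob_le_of_le_half:
  fixes p :: real
  assumes p: "0 < p" "p \<le> 1 / 2"
  shows "real (k choose j) * p ^ j * (1 - p) ^ (k - j) \<le> 1 / (2 * p) / sqrt (real k + 1)"
proof -
  define r where "r = 2 * p"
  have r: "0 < r" "r \<le> 1" using p by (auto simp: r_def)
  define a where "a = sqrt (real k + 1)"
  have a: "a > 0" "a * a = real k + 1" by (auto simp: a_def)
  let ?w = "\<lambda>m. real (k choose m) * r ^ m * (1 - r) ^ (k - m)"
  have w0: "?w m \<ge> 0" for m using r by simp
  have w1: "(\<Sum>m\<le>k. ?w m) = 1"
    using binomial_ring[of r "1 - r" k] by simp
  \<comment> \<open>the inequality of arithmetic and geometric means replaces \<open>1 / sqrt (m + 1)\<close> by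
    a function of \<open>1 / (m + 1)\<close>, whose mean is explicit\<close>
  have step: "real (m choose j) * (1/2) ^ j * (1 - 1/2) ^ (m - j)
      \<le> (a / (real m + 1) + 1 / a) / 2" for m
  proof (cases "j \<le> m")
    case False
    then show ?thesis using a by (simp add: binomial_eq_0)
  next
    case True
    have "real (m choose j) * (1/2) ^ j * (1 - 1/2) ^ (m - j) = real (m choose j) / 2 ^ m"
      using True by (simp add: power_divide mult.assoc flip: power_add)
    also have "\<dots> \<le> 1 / sqrt (real m + 1)"
      using binomial_le_two_power_div_sqrt[of m j] by (simp add: field_simps)
    also have "\<dots> \<le> (a / (real m + 1) + 1 / a) / 2"
    proof -
      define b where "b = sqrt (real m + 1)"
      have b: "b > 0" "real m + 1 = b * b" by (auto simp: b_def)
      have "2 * (a * b) \<le> a * a + b * b"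
        using sum_squares_bound[of a b] by (simp add: power2_eq_square)
      then have "1 / b \<le> (a / (b * b) + 1 / a) / 2"
        using a b by (simp add: field_simps)
      then show ?thesis by (simp add: b_def)
    qed
    finally show ?thesis .
  qed
  have "real (k choose j) * p ^ j * (1 - p) ^ (k - j)
      = (\<Sum>m\<le>k. ?w m * (real (m choose j) * (1/2) ^ j * (1 - 1/2) ^ (m - j)))"
    using binomial_thinning[of k r j "1/2"] by (simp add: r_def)
  also have "\<dots> \<le> (\<Sum>m\<le>k. ?w m * ((a / (real m + 1) + 1 / a) / 2))"
    by (intro sum_mono mult_left_mono step w0)
  also have "\<dots> = (\<Sum>m\<le>k. (a / 2) * (?w m / (real m + 1)) + ?w m * (1 / a / 2))"
  proof (intro sum.cong refl)
    have "w * ((a / x + 1 / a) / 2) = (a / 2) * (w / x) + w * (1 / a / 2)" for w x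
      by (simp add: add_divide_distrib distrib_left mult.commute)
    then show "?w m * ((a / (real m + 1) + 1 / a) / 2)
        = (a / 2) * (?w m / (real m + 1)) + ?w m * (1 / a / 2)" for m .
  qed
  also have "\<dots> = (a / 2) * (\<Sum>m\<le>k. ?w m / (real m + 1)) + 1 / a / 2"
    by (simp only: sum.distrib sum_distrib_left[symmetric] sum_distrib_right[symmetric] w1 mult_1)
  also have "\<dots> \<le> (a / 2) * (1 / ((real k + 1) * r)) + 1 / a / 2"
    using a by (intro add_right_mono mult_left_mono binomial_mean_inverse_Suc_le r) auto
  also have "\<dots> = (1 / r + 1) / 2 / a"
    unfolding a(2)[symmetric] using a(1) r by (simp add: field_simps)
  also have "\<dots> \<le> (1 / r) / a"
    using a r by (intro divide_right_mono) (auto simp: field_simps)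
  finally show ?thesis by (simp add: r_def a_def)
qed

lemma pmf_binomial_le_div_sqrt:
  assumes p: "0 < p" "p < 1"
  shows "pmf (binomial_pmf k p) j \<le> 1 / (p * (1 - p)) / sqrt (real k + 1)"
proof (cases "j \<le> k")
  case False
  then have "pmf (binomial_pmf k p) j = 0" using p by (simp add: binomial_eq_0)
  moreover have "0 \<le> 1 / (p * (1 - p)) / sqrt (real k + 1)" using p by simp
  ultimately show ?thesis by linarith
next
  case True
  have "pmf (binomial_pmf k p) j = real (k choose j) * p ^ j * (1 - p) ^ (k - j)"
    using p by simp
  also have "\<dots> \<le> 1 / (p * (1 - p)) / sqrt (real k + 1)"
  proof (cases "p \<le> 1 / 2")
    case half: True
    have "1 / (2 * p) \<le> 1 / (p * (1 - p))"
      using p by (intro divide_left_mono) (auto simp: mult_ac)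
    then have "1 / (2 * p) / sqrt (real k + 1) \<le> 1 / (p * (1 - p)) / sqrt (real k + 1)"
      by (rule divide_right_mono) simp
    then show ?thesis
      using binomial_prob_le_of_le_half[OF p(1) half, of k j] by linarith
  next
    case half: False
    have "real (k choose j) * p ^ j * (1 - p) ^ (k - j)
        = real (k choose (k - j)) * (1 - p) ^ (k - j) * (1 - (1 - p)) ^ (k - (k - j))"
      using True binomial_symmetric[of j k] by simp
    also have "\<dots> \<le> 1 / (2 * (1 - p)) / sqrt (real k + 1)"
      using p half by (intro binomial_prob_le_of_le_half) auto
    also have "\<dots> \<le> 1 / (p * (1 - p)) / sqrt (real k + 1)"
      using p by (intro divide_right_mono divide_left_mono mult_right_mono) auto
    finally show ?thesis .
  qed
  finally show ?thesis .
qed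

section \<open>The transition kernel\<close>

text \<open>Terms with \<open>y > k\<close> vanish because the binomial law does not charge them.\<close>

lemma pmf_mminf_law:
  assumes "0 < mu" "0 < s"
  shows "pmf (mminf_law mu mu s k) n =
    (\<Sum>y\<le>n. pmf (binomial_pmf k (exp (- (mu * s)))) y *
             pmf (poisson_pmf (1 - exp (- (mu * s)))) (n - y))"
proof -
  let ?A = "binomial_pmf k (exp (- (mu * s)))" and ?B = "poisson_pmf (1 - exp (- (mu * s)))"
  have "mminf_law mu mu s k = bind_pmf ?A (\<lambda>y. map_pmf ((+) y) ?B)"
    using assms
    by (simp add: mminf_law_def poisson0_pmf_def pair_pmf_def map_pmf_def bind_assoc_pmf
        bind_return_pmf)
  then have "pmf (mminf_law mu mu s k) n
      = measure_pmf.expectation ?A (\<lambda>y. pmf (map_pmf ((+) y) ?B) n)"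
    by (simp add: pmf_bind)
  also have "\<dots> = (\<Sum>y\<le>n. pmf (map_pmf ((+) y) ?B) n * pmf ?A y)"
  proof (intro integral_measure_pmf_real)
    show "y \<in> {..n}" if "pmf (map_pmf ((+) y) ?B) n \<noteq> 0" for y
      using that pmf_map_outside[of n "(+) y" ?B] by (force simp: image_iff)
  qed simp
  also have "\<dots> = (\<Sum>y\<le>n. pmf ?A y * pmf ?B (n - y))"
  proof (intro sum.cong refl)
    fix y assume "y \<in> {..n}"
    then have "pmf (map_pmf ((+) y) ?B) n = pmf (map_pmf ((+) y) ?B) (y + (n - y))" by simp
    also have "\<dots> = pmf ?B (n - y)"
      by (intro pmf_map_inj') (auto simp: inj_on_def)
    finally show "pmf (map_pmf ((+) y) ?B) n * pmf ?A y = pmf ?A y * pmf ?B (n - y)"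
      by (simp only: mult.commute)
  qed
  finally show ?thesis .
qed

lemma mminf_law_reversible:
  assumes "0 < mu" "0 < s"
  shows "pmf (poisson_pmf 1) n * pmf (mminf_law mu mu s n) k
       = pmf (poisson_pmf 1) k * pmf (mminf_law mu mu s k) n"
proof -
  define p where "p = exp (- (mu * s))"
  have p: "0 < p" "p < 1" using assms by (auto simp: p_def)
  \<comment> \<open>the joint weight of \<open>n\<close> customers at first, \<open>k\<close> at time \<open>s\<close>, and \<open>y\<close> present at both
    times; it is symmetric in \<open>n\<close> and \<open>k\<close>\<close>
  define w where "w n k y = exp (- 1) * exp (- (1 - p)) * p ^ y * (1 - p) ^ (n - y) *
    (1 - p) ^ (k - y) / (fact y * fact (n - y) * fact (k - y))" for n k y :: nat
  have *: "pmf (poisson_pmf 1) n * pmf (mminf_law mu mu s n) k = (\<Sum>y\<le>min n k. w n k y)" for n k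
  proof -
    have "pmf (poisson_pmf 1) n * pmf (mminf_law mu mu s n) k =
      (\<Sum>y\<le>k. pmf (poisson_pmf 1) n *
        (pmf (binomial_pmf n p) y * pmf (poisson_pmf (1 - p)) (k - y)))"
      unfolding pmf_mminf_law[OF assms] p_def[symmetric] by (simp only: sum_distrib_left)
    also have "\<dots> = (\<Sum>y\<le>min n k. pmf (poisson_pmf 1) n *
        (pmf (binomial_pmf n p) y * pmf (poisson_pmf (1 - p)) (k - y)))"
      using p by (intro sum.mono_neutral_right) auto
    also have "\<dots> = (\<Sum>y\<le>min n k. w n k y)"
      using p by (intro sum.cong refl) (auto simp: w_def binomial_fact field_simps)
    finally show ?thesis .
  qed
  show ?thesis
    unfolding * by (intro sum.cong) (auto simp: w_def min.commute mult_ac)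
qed

lemma pmf_mminf_law_le_div_sqrt:
  assumes "0 < mu" "0 < s"
  defines "p \<equiv> exp (- (mu * s))"
  shows "pmf (mminf_law mu mu s k) n \<le> exp 1 / (p * (1 - p)) / sqrt (real n + 1)"
proof -
  have p: "0 < p" "p < 1" using assms by auto
  define q where "q = 1 - p"
  have q: "0 < q" "q < 1" using p by (auto simp: q_def)
  define D where "D = 1 / (p * (1 - p))"
  have D: "D > 0" using p by (simp add: D_def)
  \<comment> \<open>since \<open>n + 1 \<le> (y + 1) * (n - y + 1)\<close>, a factor that depends only on the Poisson
    summand \<open>n - y\<close> turns the bound in terms of \<open>y\<close> into one in terms of \<open>n\<close>\<close>
  have bin: "pmf (binomial_pmf k p) y \<le> D / sqrt (real n + 1) * (real (n - y) + 1)"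
    if "y \<le> n" for y
  proof (cases "y \<le> k")
    case False
    then show ?thesis using p D by (simp add: binomial_eq_0)
  next
    case True
    have "pmf (binomial_pmf k p) y \<le> D / sqrt (real k + 1)"
      unfolding D_def by (rule pmf_binomial_le_div_sqrt[OF p])
    also have "\<dots> \<le> D / sqrt (real y + 1)"
      using True D by (intro divide_left_mono) auto
    also have "\<dots> \<le> D / sqrt (real n + 1) * (real (n - y) + 1)"
    proof -
      have "real n + 1 \<le> (real y + 1) * (real (n - y) + 1)"
      proof -
        have "n + 1 \<le> (y + 1) * (n - y + 1)"
          using that by (auto simp: le_iff_add)
        then have "real (n + 1) \<le> real ((y + 1) * (n - y + 1))"
          using of_nat_le_iff by blast
        then show ?thesis by (simp only: of_nat_mult of_nat_add of_nat_1)
      qed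
      also have "\<dots> \<le> (real y + 1) * (real (n - y) + 1)\<^sup>2"
        by (intro mult_left_mono) (auto simp: power2_eq_square)
      finally have "sqrt (real n + 1) \<le> sqrt ((real y + 1) * (real (n - y) + 1)\<^sup>2)"
        by (rule real_sqrt_le_mono)
      also have "\<dots> = sqrt (real y + 1) * (real (n - y) + 1)"
        by (simp add: real_sqrt_mult)
      finally have "1 / sqrt (real y + 1) \<le> (real (n - y) + 1) / sqrt (real n + 1)"
        by (simp add: field_simps)
      from mult_left_mono[OF this, of D] show ?thesis using D by simp
    qed
    finally show ?thesis .
  qed
  \<comment> \<open>a truncated mean of \<open>1 +\<close> the Poisson variable, estimated through \<open>i + 1 \<le> 2 ^ i\<close>\<close>
  have poi: "(\<Sum>i\<le>n. (real i + 1) * pmf (poisson_pmf q) i) \<le> exp 1"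
  proof -
    have "(\<Sum>i\<le>n. (real i + 1) * pmf (poisson_pmf q) i)
        \<le> (\<Sum>i\<le>n. exp (- q) * ((2 * q) ^ i /\<^sub>R fact i))"
    proof (intro sum_mono)
      fix i
      have "Suc i \<le> 2 ^ i" by (simp add: Suc_leI)
      then have "real (Suc i) \<le> real (2 ^ i)" using of_nat_le_iff by blast
      then have "(real i + 1) * pmf (poisson_pmf q) i \<le> 2 ^ i * pmf (poisson_pmf q) i"
        by (intro mult_right_mono) (auto simp: add.commute)
      then show "(real i + 1) * pmf (poisson_pmf q) i \<le> exp (- q) * ((2 * q) ^ i /\<^sub>R fact i)"
        using q by (simp add: power_mult_distrib field_simps)
    qed
    also have "\<dots> = exp (- q) * (\<Sum>i\<le>n. (2 * q) ^ i /\<^sub>R fact i)"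
      by (simp only: sum_distrib_left)
    also have "\<dots> \<le> exp (- q) * exp (2 * q)"
    proof (rule mult_left_mono)
      show "(\<Sum>i\<le>n. (2 * q) ^ i /\<^sub>R fact i) \<le> exp (2 * q)"
        unfolding exp_def using q by (intro sum_le_suminf summable_exp_generic) auto
    qed simp
    also have "\<dots> \<le> exp 1" using q by (simp flip: exp_add)
    finally show ?thesis .
  qed
  have "pmf (mminf_law mu mu s k) n
      = (\<Sum>y\<le>n. pmf (binomial_pmf k p) y * pmf (poisson_pmf q) (n - y))"
    unfolding q_def p_def by (rule pmf_mminf_law[OF assms(1,2)])
  also have "\<dots> \<le> (\<Sum>y\<le>n. D / sqrt (real n + 1) * (real (n - y) + 1) *
      pmf (poisson_pmf q) (n - y))"
    by (intro sum_mono mult_right_mono bin) auto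
  also have "\<dots> = D / sqrt (real n + 1) *
      (\<Sum>y\<le>n. (real (n - y) + 1) * pmf (poisson_pmf q) (n - y))"
    by (simp only: sum_distrib_left mult.assoc)
  also have "(\<Sum>y\<le>n. (real (n - y) + 1) * pmf (poisson_pmf q) (n - y))
      = (\<Sum>i\<le>n. (real i + 1) * pmf (poisson_pmf q) i)"
    by (rule sum.reindex_bij_witness[of _ "\<lambda>i. n - i" "\<lambda>i. n - i"]) auto
  also have "D / sqrt (real n + 1) * \<dots> \<le> D / sqrt (real n + 1) * exp 1"
    using D by (intro mult_left_mono poi) auto
  finally show ?thesis by (simp add: D_def)
qed

lemma mminf_semigroup_le:
  fixes f :: "nat \<Rightarrow> real"
  assumes "0 < mu" "0 < s"
    and f: "\<And>k. 0 \<le> f k" "integrable (measure_pmf (poisson_pmf 1)) f"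
           "measure_pmf.expectation (poisson_pmf 1) f = 1"
    and B: "\<And>k. pmf (mminf_law mu mu s k) n \<le> B"
  shows "mminf_semigroup mu mu s f n \<le> B * exp 1 * fact n"
proof -
  have int: "integrable (measure_pmf q) f \<longleftrightarrow> integrable (count_space UNIV) (\<lambda>k. pmf q k * f k)"
    and ex: "measure_pmf.expectation q f = (\<integral>k. pmf q k * f k \<partial>count_space UNIV)"
    for q :: "nat pmf"
    by (simp_all add: measure_pmf_eq_density integrable_density integral_density)
  let ?L = "mminf_law mu mu s n" and ?D = "B * exp 1 * fact n"
  \<comment> \<open>by reversibility the law at time \<open>s\<close> has a bounded density with respect to \<open>\<pi>\<close>\<close>
  have dens: "pmf ?L k \<le> ?D * pmf (poisson_pmf 1) k" for k
  proof -
    have "exp (- 1) / fact n * pmf ?L k = pmf (poisson_pmf 1) k * pmf (mminf_law mu mu s k) n"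
      using mminf_law_reversible[OF assms(1,2), of n k] by simp
    also have "\<dots> \<le> pmf (poisson_pmf 1) k * B"
      by (intro mult_left_mono B) simp
    finally show ?thesis
      by (simp add: exp_minus field_simps)
  qed
  have "mminf_semigroup mu mu s f n = (\<integral>k. pmf ?L k * f k \<partial>count_space UNIV)"
    unfolding mminf_semigroup_def ex ..
  also have "\<dots> \<le> (\<integral>k. ?D * (pmf (poisson_pmf 1) k * f k) \<partial>count_space UNIV)"
  proof (rule integral_mono)
    show "integrable (count_space UNIV) (\<lambda>k. pmf ?L k * f k)"
      using integrable_mminf_law[OF assms(1,2) f(2)] unfolding int .
    show "integrable (count_space UNIV) (\<lambda>k. ?D * (pmf (poisson_pmf 1) k * f k))"
      using f(2) unfolding int by (rule integrable_mult_right)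
    show "pmf ?L k * f k \<le> ?D * (pmf (poisson_pmf 1) k * f k)" for k
      using mult_right_mono[OF dens f(1)] by (simp only: mult.assoc)
  qed
  also have "\<dots> = ?D"
    using f(3) unfolding ex by (simp del: pmf_poisson)
  finally show ?thesis .
qed

section \<open>The deviation bound\<close>

lemma poisson_one_tail_le: "measure_pmf.prob (poisson_pmf 1) {n..} \<le> 1 / fact n"
proof -
  define g :: "nat \<Rightarrow> real" where "g m = exp (- 1) / fact n * (1 ^ m /\<^sub>R fact m)" for m
  have g: "g sums (exp (- 1) / fact n * exp 1)"
    unfolding g_def by (intro sums_mult exp_converges)
  have le: "pmf (poisson_pmf 1) (m + n) \<le> g m" for m
  proof -
    have "fact m * fact n \<le> (fact (m + n) :: nat)"
      by (intro dvd_imp_le fact_fact_dvd_fact) simp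
    then have "real (fact m * fact n) \<le> real (fact (m + n))"
      using of_nat_le_iff by blast
    then have "exp (- 1) / fact (m + n) \<le> exp (- 1) / (fact m * fact n :: real)"
      by (intro divide_left_mono) auto
    then show ?thesis by (simp add: g_def field_simps)
  qed
  have summ: "summable (\<lambda>m. pmf (poisson_pmf 1) (m + n))"
    by (rule summable_comparison_test'[OF sums_summable[OF g], of 0])
      (use le in \<open>simp del: pmf_poisson\<close>)
  have "measure_pmf.prob (poisson_pmf 1) {n..} = infsetsum (pmf (poisson_pmf 1)) {n..}"
    by (rule measure_pmf_conv_infsetsum)
  also have "\<dots> = infsetsum (\<lambda>m. pmf (poisson_pmf 1) (m + n)) UNIV"
    by (rule infsetsum_reindex_bij_betw[symmetric])
      (rule bij_betwI[where g = "\<lambda>k. k - n"], auto)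
  also have "\<dots> = (\<Sum>m. pmf (poisson_pmf 1) (m + n))"
    using summ by (intro infsetsum_nat') (simp add: abs_summable_on_nat_iff' del: pmf_poisson)
  also have "\<dots> \<le> (\<Sum>m. g m)"
    using le summ sums_summable[OF g] by (rule suminf_le)
  also have "\<dots> = 1 / fact n"
    using g by (simp add: sums_iff flip: exp_add)
  finally show ?thesis .
qed

lemma one_less_ln_four: "1 < ln (4::real)"
proof -
  have "exp 1 < (4::real)" using exp_le by linarith
  then have "ln (exp 1) < ln (4::real)" by (subst ln_less_cancel_iff) auto
  then show ?thesis by simp
qed

text \<open>If \<open>n + 1 \<ge> ln t\<close>, the bound holds because \<open>ln (ln t)\<close> is bounded away from \<open>0\<close> for \<open>t \<ge> 4\<close>;
  otherwise \<open>n! \<le> (n + 1) ^ n\<close> gives \<open>ln t \<le> 1 + n * ln (n + 1) \<le> 1 + n * ln (ln t)\<close>.\<close>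

lemma ln_le_mult_ln_ln:
  assumes t: "4 \<le> t" "t \<le> exp 1 * fact n"
  shows "ln t \<le> (1 + 1 / ln (ln 4)) * (real n + 1) * ln (ln t)"
proof -
  have ln4: "1 < ln (4::real)"
    by (rule one_less_ln_four)
  have l4: "ln (ln (4::real)) > 0" using ln4 by simp
  define m where "m = real n + 1"
  have m: "m \<ge> 1" by (simp add: m_def)
  have lt: "ln 4 \<le> ln t" using t by simp
  have llt: "ln (ln 4) \<le> ln (ln t)" using ln4 lt by simp
  have one: "1 \<le> 1 / ln (ln 4) * ln (ln t)"
    using l4 llt by (simp add: field_simps)
  have le: "m \<le> 1 / ln (ln 4) * m * ln (ln t)"
    using mult_left_mono[OF one, of m] m by (simp add: mult_ac)
  show ?thesis
  proof (cases "ln t \<le> m")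
    case True
    have "0 \<le> m * ln (ln t)" using m l4 llt by (intro mult_nonneg_nonneg) linarith+
    then show ?thesis using True le unfolding m_def[symmetric] by (simp add: algebra_simps)
  next
    case False
    have "fact n \<le> (real n + 1) ^ n"
    proof -
      have "fact n \<le> real (n ^ n)"
        using fact_le_power[of n, where 'a = real] by simp
      also have "\<dots> \<le> (real n + 1) ^ n" by (simp add: power_mono)
      finally show ?thesis .
    qed
    then have "exp 1 * fact n \<le> exp 1 * m ^ n" by (simp add: m_def)
    with t(2) have "t \<le> exp 1 * m ^ n" by (rule order_trans)
    then have "ln t \<le> ln (exp 1 * m ^ n)" using t m by (subst ln_le_cancel_iff) auto
    also have "\<dots> = 1 + real n * ln m" using m by (simp add: ln_mult ln_realpow)
    also have "\<dots> \<le> m + m * ln (ln t)"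
      using False m by (intro add_mono mult_mono) (auto simp: m_def)
    finally show ?thesis using le unfolding m_def[symmetric] by (simp add: algebra_simps)
  qed
qed

theorem theorem3p11:
  fixes lam mu :: real
  assumes "lam = mu" and "0 < mu"
  shows "\<forall>s>0. \<exists>c::real. \<forall>t\<ge>4.
    (SUP f \<in> {f :: nat \<Rightarrow> real. (\<forall>n. 0 \<le> f n)
                \<and> integrable (measure_pmf (poisson_pmf 1)) f
                \<and> measure_pmf.expectation (poisson_pmf 1) f = 1}.
       measure_pmf.prob (poisson_pmf 1) {n. mminf_semigroup lam mu s f n \<ge> t})
    \<le> c * sqrt (ln (ln t)) / (t * sqrt (ln t))"
proof (intro allI impI)
  fix s :: real assume s: "0 < s"
  define p where "p = exp (- (mu * s))"
  have p: "0 < p" "p < 1" using assms s by (auto simp: p_def)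
  define B where "B = exp 1 / (p * (1 - p))"
  have B: "B > 0" using p by (simp add: B_def)
  define A where "A = 1 + 1 / ln (ln (4::real))"
  have ln4: "1 < ln (4::real)"
    by (rule one_less_ln_four)
  have A: "A > 0" using ln4 by (simp add: A_def add_pos_pos)
  define c where "c = B * exp 1 * sqrt A"
  have c: "c > 0" using A B by (simp add: c_def)
  have bound: "measure_pmf.prob (poisson_pmf 1) {n. mminf_semigroup lam mu s f n \<ge> t}
      \<le> c * sqrt (ln (ln t)) / (t * sqrt (ln t))"
    if t: "t \<ge> 4" and f: "\<And>n. 0 \<le> f n" "integrable (measure_pmf (poisson_pmf 1)) f"
      "measure_pmf.expectation (poisson_pmf 1) f = 1" for t :: real and f :: "nat \<Rightarrow> real"
  proof -
    define E where "E = {n. mminf_semigroup lam mu s f n \<ge> t}"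
    have "ln 4 \<le> ln t" using t by simp
    then have lt: "1 < ln t" using ln4 by linarith
    show ?thesis
    proof (cases "E = {}")
      case True
      then show ?thesis using c t lt unfolding E_def by simp
    next
      case False
      define n where "n = (LEAST n. n \<in> E)"
      have nE: "n \<in> E" using False unfolding n_def by (auto intro: LeastI)
      have sub: "E \<subseteq> {n..}" unfolding n_def by (auto intro: Least_le)
      have t1: "t \<le> mminf_semigroup mu mu s f n" using nE assms by (simp add: E_def)
      have "t \<le> 1 * exp 1 * fact n"
        using t1 mminf_semigroup_le[OF assms(2) s f pmf_le_1] by (rule order_trans)
      then have ln_t: "ln t \<le> A * (real n + 1) * ln (ln t)"
        unfolding A_def using t by (intro ln_le_mult_ln_ln) auto
      have t2: "t \<le> B / sqrt (real n + 1) * exp 1 * fact n"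
        using t1 mminf_semigroup_le[OF assms(2) s f pmf_mminf_law_le_div_sqrt[OF assms(2) s]]
        unfolding B_def p_def by (rule order_trans)
      have "sqrt (ln t) \<le> sqrt A * sqrt (real n + 1) * sqrt (ln (ln t))"
        using real_sqrt_le_mono[OF ln_t] by (simp add: real_sqrt_mult)
      then have inv: "1 / sqrt (real n + 1) \<le> sqrt A * sqrt (ln (ln t)) / sqrt (ln t)"
        using lt by (simp add: field_simps)
      have "measure_pmf.prob (poisson_pmf 1) E \<le> measure_pmf.prob (poisson_pmf 1) {n..}"
        using sub by (intro measure_pmf.finite_measure_mono) auto
      also have "\<dots> \<le> 1 / fact n" by (rule poisson_one_tail_le)
      also have "\<dots> \<le> B * exp 1 / t * (1 / sqrt (real n + 1))"
        using t2 t by (simp add: field_simps)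
      also have "\<dots> \<le> B * exp 1 / t * (sqrt A * sqrt (ln (ln t)) / sqrt (ln t))"
        using inv B t by (intro mult_left_mono) auto
      also have "\<dots> = c * sqrt (ln (ln t)) / (t * sqrt (ln t))"
        by (simp add: c_def)
      finally show ?thesis unfolding E_def .
    qed
  qed
  let ?F = "{f :: nat \<Rightarrow> real. (\<forall>n. 0 \<le> f n)
                \<and> integrable (measure_pmf (poisson_pmf 1)) f
                \<and> measure_pmf.expectation (poisson_pmf 1) f = 1}"
  have "(\<lambda>_. 1) \<in> ?F" by simp
  then have ne: "?F \<noteq> {}" by blast
  have "(SUP f \<in> ?F. measure_pmf.prob (poisson_pmf 1) {n. mminf_semigroup lam mu s f n \<ge> t})
      \<le> c * sqrt (ln (ln t)) / (t * sqrt (ln t))" if "t \<ge> 4" for t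
    using ne by (rule cSUP_least) (rule bound, use that in auto)
  then show "\<exists>c::real. \<forall>t\<ge>4.
    (SUP f \<in> ?F. measure_pmf.prob (poisson_pmf 1) {n. mminf_semigroup lam mu s f n \<ge> t})
    \<le> c * sqrt (ln (ln t)) / (t * sqrt (ln t))"
    by blast
qed

end
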